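(* Let $\mathbf F$ be a three-dimensional oriented real Euclidean vector space, with scalar product $(\mathbf v,\mathbf w)\mapsto\mathbf v\cdot\mathbf w$, let $G\cong SO(3)$ be its group of orientation-preserving linear isometries, with Lie algebra $\mathfrak g$ identified with $\mathbf F$, and let $S_R\subset\mathbf F\equiv\mathfrak g^*$ be the sphere of radius $R>0$ centred at $0$, considered as a coadjoint orbit of $G$, on which $G$ acts by the (Hamiltonian) coadjoint action, the moment map $J$ being the canonical injection $S_R\hookrightarrow\mathbf F\equiv\mathfrak g^*$. Then the set $\Omega$ of generalized temperatures is the whole Lie algebra $\mathfrak g\equiv\mathbf F$. For $\boldsymbol\beta\in\mathbf F$, choose a positively oriented orthonormal basis $(\mathbf e_x,\mathbf e_y,\mathbf e_z)$ of $\mathbf F$ such that $\boldsymbol\beta=\beta\,\mathbf e_z$ with $\beta\ge 0$. The partition function and the probability density (with respect to the Liouville measure) of the Gibbs state indexed by $\boldsymbol\beta$ are $$P(\boldsymbol\beta)=\begin{cases}\dfrac{4\pi\sinh(R\beta)}{\beta}&\text{if }\beta>0,\\[2mm] 4\pi R&\text{if }\beta=0,\end{cases}\qquad \rho_{\boldsymbol\beta}(\mathbf r)=\begin{cases}\dfrac{\beta\exp(-\beta z)}{4\pi\sinh(R\beta)}&\text{if }\beta>0,\\[2mm] \dfrac1{4\pi R}&\text{if }\beta=0,\end{cases}$$ for $\mathbf r=x\mathbf e_x+y\mathbf e_y+z\mathbf e_z\in S_R$. When $\beta>0$, the mean value of the moment map and the entropy are $$E_J(\boldsymbol\beta)=\frac{1-R\beta\coth(R\beta)}{\beta^2}\,\boldsymbol\beta,\qquad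 S(\boldsymbol\beta)=1+\log\left(\frac{4\pi\sinh(R\beta)}{\beta}\right)-R\beta\coth(R\beta).$$
   Context: Identifications: $\mathbf F$ is identified with $\mathfrak g$ by $\mathbf v\mapsto(\mathbf w\mapsto\mathbf v\times\mathbf w)$, and with $\mathfrak g^*$ by means of the scalar product, so that the pairing of $\mathbf r\in\mathbf F\equiv\mathfrak g^*$ with $\boldsymbol\beta\in\mathbf F\equiv\mathfrak g$ is $\langle\mathbf r,\boldsymbol\beta\rangle=\mathbf r\cdot\boldsymbol\beta$. The coadjoint action becomes the natural action of $G$ on $\mathbf F$. The symplectic form of the coadjoint orbit $S_R$ is $\omega_{S_R}=d\varphi\wedge dz$, where $\varphi$ is the angular coordinate defined by $x=\sqrt{x^2+y^2}\cos\varphi$, $y=\sqrt{x^2+y^2}\sin\varphi$ (the area form of $S_R$ is $R\,\omega_{S_R}$), and the Liouville measure is $\lambda(d\mathbf r)=dz\,d\varphi$, i.e. $1/R$ times the usual area measure of $S_R$. Definitions (for a moment map $J:M\to\mathfrak g^*$ on a symplectic manifold $M$ with Liouville measure $\lambda$): $\boldsymbol\beta\in\mathfrak g$ is a generalized temperature if the integral $\int_M\exp(-\langle J(x),\boldsymbol\beta\rangle)\lambda(dx)$ is normally convergent, i.e. there exist an open neighbourhood $U$ of $\boldsymbol\beta$ in $\mathfrak g$ and a $\lambda$-integrable function $f:M\to\mathbb R^+$ with $\exp(-\langle J(x),\boldsymbol\beta'\rangle)\le f(x)$ for all $\boldsymbol\beta'\in U$, $x\in M$. $\Omega$ is the set of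 generalized temperatures. For $\boldsymbol\beta\in\Omega$: partition function $P(\boldsymbol\beta)=\int_M\exp(-\langle J(x),\boldsymbol\beta\rangle)\lambda(dx)$; Gibbs state indexed by $\boldsymbol\beta$: probability measure of density $\rho_{\boldsymbol\beta}(x)=P(\boldsymbol\beta)^{-1}\exp(-\langle J(x),\boldsymbol\beta\rangle)$ with respect to $\lambda$; mean value of $J$: $E_J(\boldsymbol\beta)=\int_M J\rho_{\boldsymbol\beta}\,d\lambda\in\mathfrak g^*$; entropy: $S(\boldsymbol\beta)=-\int_M\rho_{\boldsymbol\beta}\log\rho_{\boldsymbol\beta}\,d\lambda$. *)

theory Defs
  imports "HOL-Analysis.Analysis"
begin

text \<open>
  Ordered bases of a three-dimensional space are families indexed by the type \<open>3\<close>; the members,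
  in order, are \<open>b 1\<close>, \<open>b 2\<close>, \<open>b 3\<close>.
\<close>

definition ordered_basis :: "(3 \<Rightarrow> 'a::euclidean_space) \<Rightarrow> bool" where
  "ordered_basis b \<longleftrightarrow> inj b \<and> independent (range b) \<and> span (range b) = UNIV"

definition same_orientation :: "((3 \<Rightarrow> 'a::euclidean_space) \<times> (3 \<Rightarrow> 'a)) set" where
  "same_orientation = {(b, c). ordered_basis b \<and> ordered_basis c \<and>
     (\<exists>A::real^3^3. (\<forall>i. c i = (\<Sum>j\<in>UNIV. A $ i $ j *\<^sub>R b j)) \<and> det A > 0)}"

definition orientations :: "(3 \<Rightarrow> 'a::euclidean_space) set set" where
  "orientations = {b. ordered_basis b} // same_orientation"

definition positive_orthonormal_basis ::
    "(3 \<Rightarrow> 'a::euclidean_space) set \<Rightarrow> (3 \<Rightarrow> 'a) \<Rightarrow> bool" where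
  "positive_orthonormal_basis Or e \<longleftrightarrow>
     e \<in> Or \<and> (\<forall>i j. e i \<bullet> e j = (if i = j then 1 else 0))"

definition cylindrical_point :: "(3 \<Rightarrow> 'a::euclidean_space) \<Rightarrow> real \<Rightarrow> real \<times> real \<Rightarrow> 'a" where
  "cylindrical_point e R = (\<lambda>(z, \<phi>).
     (sqrt (R\<^sup>2 - z\<^sup>2) * cos \<phi>) *\<^sub>R e 1 + (sqrt (R\<^sup>2 - z\<^sup>2) * sin \<phi>) *\<^sub>R e 2 + z *\<^sub>R e 3)"

text \<open>
  The symplectic form of the orbit \<open>sphere 0 R\<close> is \<open>d\<phi> \<and> dz\<close>, so its Liouville measure is
  \<open>dz d\<phi>\<close>: the image of the Lebesgue measure of \<open>{-R<..<R} \<times> {0..<2 * pi}\<close> under the cylindrical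
  coordinates, which map that rectangle bijectively onto the sphere minus its two poles
  \<open>\<plusminus>R *\<^sub>R e 3\<close>; the poles form a null set.
\<close>

definition sphere_liouville_measure ::
    "(3 \<Rightarrow> 'a::euclidean_space) \<Rightarrow> real \<Rightarrow> 'a measure" where
  "sphere_liouville_measure e R =
     distr (restrict_space lborel ({-R<..<R} \<times> {0..<2 * pi}))
           (restrict_space borel (sphere 0 R))
           (cylindrical_point e R)"

text \<open>
  Here \<open>M\<close> is the Liouville measure (with the symplectic manifold as its space) and \<open>J\<close> is the
  moment map.  Both the Lie algebra and its dual are identified with a Euclidean space, so
  that their pairing is the inner product.
\<close>

definition generalized_temperatures ::
    "'m measure \<Rightarrow> ('m \<Rightarrow> 'a::euclidean_space) \<Rightarrow> 'a set" where
  "generalized_temperatures M J = {\<beta>. \<exists>U f. open U \<and> \<beta> \<in> U \<and>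
     integrable M f \<and> (\<forall>x\<in>space M. 0 \<le> f x) \<and>
     (\<forall>\<beta>'\<in>U. \<forall>x\<in>space M. exp (- (J x \<bullet> \<beta>')) \<le> (f x :: real))}"

definition partition_function ::
    "'m measure \<Rightarrow> ('m \<Rightarrow> 'a::euclidean_space) \<Rightarrow> 'a \<Rightarrow> real" where
  "partition_function M J \<beta> = (\<integral>x. exp (- (J x \<bullet> \<beta>)) \<partial>M)"

definition gibbs_density ::
    "'m measure \<Rightarrow> ('m \<Rightarrow> 'a::euclidean_space) \<Rightarrow> 'a \<Rightarrow> 'm \<Rightarrow> real" where
  "gibbs_density M J \<beta> x = exp (- (J x \<bullet> \<beta>)) / partition_function M J \<beta>"

definition mean_moment ::
    "'m measure \<Rightarrow> ('m \<Rightarrow> 'a::euclidean_space) \<Rightarrow> 'a \<Rightarrow> 'a" where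
  "mean_moment M J \<beta> = (\<integral>x. gibbs_density M J \<beta> x *\<^sub>R J x \<partial>M)"

definition gibbs_entropy ::
    "'m measure \<Rightarrow> ('m \<Rightarrow> 'a::euclidean_space) \<Rightarrow> 'a \<Rightarrow> real" where
  "gibbs_entropy M J \<beta> = - (\<integral>x. gibbs_density M J \<beta> x * ln (gibbs_density M J \<beta> x) \<partial>M)"

definition coth :: "real \<Rightarrow> real" where
  "coth x = cosh x / sinh x"

end

theory Submission
  imports Defs
begin

text \<open>
  The Liouville measure is defined through the cylindrical coordinates \<open>(z, \<phi>)\<close> of one fixed
  orthonormal basis, whereas a temperature \<open>\<beta>\<close> singles out another basis, whose third vector points
  along \<open>\<beta>\<close>.  Once it is known that the measure is the same for every orthonormal basis
  (\<open>sphere_liouville_measure_unique\<close>), everything can be computed in the basis adapted to \<open>\<beta>\<close>.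
  There the Gibbs weight \<open>exp (- \<beta> z)\<close> depends on \<open>z\<close> alone, so each integral splits
  into an integral over \<open>{-R..R}\<close> and one over a full turn (\<open>has_bochner_integral_liouville\<close>).  The
  mean of the moment map points along \<open>\<beta>\<close> because \<open>cos\<close> and \<open>sin\<close> integrate to zero over a full
  turn; the entropy is \<open>ln P\<close> plus the pairing of \<open>\<beta>\<close> with the mean.  Every \<open>\<beta>\<close> is a generalized
  temperature because the sphere is bounded and its Liouville measure is finite.

  Basis independence amounts to rotation invariance of the area of the sphere, and it is inherited
  from that of the volume of \<open>\<real>\<^sup>3\<close>.  The volume of the solid cone over a part \<open>A\<close> of the sphere is
  \<open>R\<^sup>2 / 3\<close> times the Liouville measure of \<open>A\<close> (\<open>measure_cone\<close>): this is the change of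
  variables to \<open>(\<rho>, z, \<phi>)\<close>, a spherical coordinate system whose Jacobian is \<open>R\<^sup>2 \<rho>\<^sup>2\<close>.  The
  coordinates with respect to two orthonormal bases differ by an orthogonal transformation, which
  maps one cone onto the other and preserves volume.
\<close>

section \<open>The volume of sectors of the ball\<close>

lemma borel_measurable_vector_3 [measurable]:
  "(\<lambda>(r, z, \<phi>). vector [r, z, \<phi>] :: real^3) \<in> borel_measurable borel"
proof -
  have "(\<lambda>(r, z, \<phi>). vector [r, z, \<phi>] :: real^3) =
      (\<lambda>p. fst p *\<^sub>R axis 1 1 + fst (snd p) *\<^sub>R axis 2 1 + snd (snd p) *\<^sub>R axis 3 1)"
    by (auto simp: fun_eq_iff vec_eq_iff forall_3 axis_def)
  then show ?thesis
    by (simp add: borel_measurable_continuous_onI continuous_intros)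
qed

text \<open>
  The change of variables theorem speaks of \<open>real^3\<close>, Fubini's theorem of iterated products; this
  identification of the two Lebesgue measures connects them.
\<close>

lemma lborel_vector_3:
  "distr lborel borel (\<lambda>(r, z, \<phi>). vector [r, z, \<phi>]) = (lborel :: (real^3) measure)"
proof (rule lborel_eqI[symmetric])
  let ?h = "\<lambda>(r, z, \<phi>). vector [r, z, \<phi>] :: real^3"
  show "sets (distr lborel borel ?h) = sets borel" by simp
  fix l u :: "real^3"
  assume "\<And>b. b \<in> Basis \<Longrightarrow> l \<bullet> b \<le> u \<bullet> b"
  from this[of "axis i 1" for i] have le: "l $ i \<le> u $ i" for i
    by (simp add: axis_in_Basis_iff inner_axis)
  have "?h -` box l u = box (l$1, l$2, l$3) (u$1, u$2, u$3)"
    by (auto simp: box_def Basis_vec_def forall_3 inner_axis Basis_prod_def)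
  then have "emeasure (distr lborel borel ?h) (box l u)
      = emeasure lborel (box (l$1, l$2, l$3) (u$1, u$2, u$3))"
    by (subst emeasure_distr) auto
  also have "\<dots> = ennreal (\<Prod>b\<in>Basis. ((u$1, u$2, u$3) - (l$1, l$2, l$3)) \<bullet> b)"
    using le by (subst emeasure_lborel_box) (auto simp: Basis_prod_def)
  also have "(\<Prod>b\<in>Basis. ((u$1, u$2, u$3) - (l$1, l$2, l$3)) \<bullet> b)
      = (\<Prod>b\<in>{(1, 0, 0), (0, 1, 0), (0, 0, 1 :: real)}. ((u$1, u$2, u$3) - (l$1, l$2, l$3)) \<bullet> b)"
    by (rule prod.cong) (auto simp: Basis_prod_def zero_prod_def)
  also have "\<dots> = (u - l)$1 * ((u - l)$2 * (u - l)$3)"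
    by simp
  also have "\<dots> = (\<Prod>i\<in>UNIV. (u - l) $ i)"
    unfolding UNIV_3 by simp
  also have "\<dots> = (\<Prod>i\<in>UNIV. (u - l) \<bullet> axis i 1)"
    by (simp add: inner_axis)
  also have "\<dots> = (\<Prod>b\<in>range (\<lambda>i. axis i 1). (u - l) \<bullet> b)"
    by (subst prod.reindex) (auto simp: inj_on_def axis_eq_axis)
  also have "range (\<lambda>i. axis i 1) = (Basis :: (real^3) set)"
    by (auto simp: Basis_vec_def)
  finally show "emeasure (distr lborel borel ?h) (box l u) = ennreal (\<Prod>b\<in>Basis. (u - l) \<bullet> b)" .
qed

text \<open>
  The latitude is measured by the height \<open>x$2\<close> on the sphere of radius \<open>R\<close> and the radius by the
  scaling factor \<open>x$1\<close>, so that \<open>x$1 = 1\<close> gives the cylindrical coordinates of the sphere itself.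
\<close>

definition spherical_coordinates :: "real \<Rightarrow> real^3 \<Rightarrow> real^3" where
  "spherical_coordinates R x =
     vector [x$1 * sqrt (R\<^sup>2 - (x$2)\<^sup>2) * cos (x$3), x$1 * sqrt (R\<^sup>2 - (x$2)\<^sup>2) * sin (x$3), x$1 * x$2]"

definition spherical_coordinates_derivative :: "real \<Rightarrow> real^3 \<Rightarrow> real^3 \<Rightarrow> real^3" where
  "spherical_coordinates_derivative R x h = (let s = sqrt (R\<^sup>2 - (x$2)\<^sup>2) in
     vector [h$1 * s * cos (x$3) - x$1 * (x$2 / s) * h$2 * cos (x$3) - x$1 * s * sin (x$3) * h$3,
             h$1 * s * sin (x$3) - x$1 * (x$2 / s) * h$2 * sin (x$3) + x$1 * s * cos (x$3) * h$3,
             h$1 * x$2 + x$1 * h$2])"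

lemma spherical_coordinates_has_derivative:
  assumes "\<bar>x$2\<bar> < R"
  shows "(spherical_coordinates R has_derivative spherical_coordinates_derivative R x) (at x within S)"
proof -
  have pos: "R\<^sup>2 - (x$2)\<^sup>2 > 0" using assms by (simp add: abs_square_less_1 power2_strict_mono)
  have nth [derivative_intros]: "((\<lambda>y. y $ i) has_derivative (\<lambda>h. h $ i)) (at x within S)" for i :: 3
    by (rule bounded_linear.has_derivative[OF bounded_linear_vec_nth has_derivative_ident])
  have "((\<lambda>y. spherical_coordinates R y $ i) has_derivative
      (\<lambda>h. spherical_coordinates_derivative R x h $ i)) (at x within S)" for i
  proof -
    consider "i = 1" | "i = 2" | "i = 3" using exhaust_3 by blast
    then show ?thesis
      by cases (use pos in \<open>auto simp: spherical_coordinates_def spherical_coordinates_derivative_def Let_def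
          fun_eq_iff field_simps intro!: derivative_eq_intros\<close>)
  qed
  then show ?thesis
    by (subst has_derivative_componentwise_within)
       (auto simp: Basis_vec_def inner_axis)
qed

text \<open>
  The Jacobian depends on \<open>x$1\<close> only.  This is Archimedes' theorem that area on the sphere is
  proportional to area in the cylindrical coordinates.
\<close>

lemma det_spherical_coordinates_derivative:
  assumes "\<bar>x$2\<bar> < R"
  shows "\<bar>det (matrix (spherical_coordinates_derivative R x))\<bar> = R\<^sup>2 * (x$1)\<^sup>2"
proof -
  define s where "s = sqrt (R\<^sup>2 - (x$2)\<^sup>2)"
  define w where "w = x$2 / s"
  have pos: "R\<^sup>2 - (x$2)\<^sup>2 > 0" using assms by (simp add: abs_square_less_1 power2_strict_mono)
  have s2: "s\<^sup>2 = R\<^sup>2 - (x$2)\<^sup>2" and ws: "w * s = x$2"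
    using pos by (auto simp: s_def w_def)
  have cs: "(cos (x$3))\<^sup>2 = 1 - (sin (x$3))\<^sup>2" by (simp add: cos_squared_eq)
  have "det (matrix (spherical_coordinates_derivative R x)) = - (R\<^sup>2 * (x$1)\<^sup>2)"
    unfolding det_3 matrix_def spherical_coordinates_derivative_def Let_def
      s_def[symmetric] w_def[symmetric]
    by (simp add: axis_def) (use s2 ws cs in algebra)
  then show ?thesis by simp
qed

lemma inner_spherical_coordinates:
  assumes "\<bar>x$2\<bar> < R"
  shows "spherical_coordinates R x \<bullet> spherical_coordinates R x = R\<^sup>2 * (x$1)\<^sup>2"
proof -
  define s where "s = sqrt (R\<^sup>2 - (x$2)\<^sup>2)"
  have "R\<^sup>2 - (x$2)\<^sup>2 > 0" using assms by (simp add: abs_square_less_1 power2_strict_mono)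
  then have s2: "s\<^sup>2 = R\<^sup>2 - (x$2)\<^sup>2" by (simp add: s_def)
  define c n where "c = cos (x$3)" and "n = sin (x$3)"
  have cn: "c\<^sup>2 + n\<^sup>2 = 1" by (simp add: c_def n_def)
  have "spherical_coordinates R x \<bullet> spherical_coordinates R x
      = (x$1)\<^sup>2 * (s\<^sup>2 * (c\<^sup>2 + n\<^sup>2) + (x$2)\<^sup>2)"
    unfolding spherical_coordinates_def s_def[symmetric] c_def[symmetric] n_def[symmetric]
    by (simp add: inner_vec_def sum_3 power2_eq_square algebra_simps)
  then show ?thesis by (simp add: s2 cn)
qed

lemma norm_spherical_coordinates:
  assumes "\<bar>x$2\<bar> < R" "0 \<le> x$1"
  shows "norm (spherical_coordinates R x) = R * x$1"
proof -
  have "norm (spherical_coordinates R x) = sqrt ((R * x$1)\<^sup>2)"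
    by (simp only: norm_eq_sqrt_inner inner_spherical_coordinates[OF assms(1)] power_mult_distrib)
  moreover have "R * x$1 \<ge> 0" using assms by simp
  ultimately show ?thesis by simp
qed

lemma polar_angle_unique:
  assumes "0 \<le> s" "s < 2 * pi" "0 \<le> t" "t < 2 * pi" "cos s = cos t" "sin s = sin t"
  shows "s = t"
proof -
  obtain n :: int where n: "s = t + 2 * pi * n" using assms sin_cos_eq_iff by metis
  then have "2 * pi * n < 2 * pi * 1" "2 * pi * (-1) < 2 * pi * n" using assms by linarith+
  then have "real_of_int n < 1" "-1 < real_of_int n"
    by (simp_all only: mult_less_cancel_left_pos pi_gt_zero mult_pos_pos zero_less_numeral)
  then have "n = 0" by linarith
  with n show ?thesis by simp
qed

lemma inj_on_spherical_coordinates: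
  assumes "R > 0"
  shows "inj_on (spherical_coordinates R)
    {x. 0 < x$1 \<and> (x$2, x$3) \<in> {-R<..<R} \<times> {0..<2 * pi}}"
proof (rule inj_onI; clarsimp)
  fix x y :: "real^3"
  assume eq: "spherical_coordinates R x = spherical_coordinates R y"
    and x: "0 < x$1" "-R < x$2" "x$2 < R" "0 \<le> x$3" "x$3 < 2 * pi"
    and y: "0 < y$1" "-R < y$2" "y$2 < R" "0 \<le> y$3" "y$3 < 2 * pi"
  have "R * x$1 = R * y$1"
    using x y eq norm_spherical_coordinates[of x R] norm_spherical_coordinates[of y R] by auto
  with assms have 1: "x$1 = y$1" by simp
  have "x$1 * x$2 = y$1 * y$2"
    using arg_cong[OF eq, of "\<lambda>v. v$3"] by (simp add: spherical_coordinates_def)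
  with 1 y have 2: "x$2 = y$2" by simp
  have "R\<^sup>2 - (y$2)\<^sup>2 > 0" using y power2_strict_mono[of "y$2" R] by auto
  then have "cos (x$3) = cos (y$3)" "sin (x$3) = sin (y$3)"
    using arg_cong[OF eq, of "\<lambda>v. v$1"] arg_cong[OF eq, of "\<lambda>v. v$2"] 1 2 y
    by (auto simp: spherical_coordinates_def)
  then have "x$3 = y$3" using x(4,5) y(4,5) polar_angle_unique[of "x$3" "y$3"] by blast
  with 1 2 show "x = y" by (simp add: vec_eq_iff forall_3)
qed

text \<open>
  Over a set \<open>B\<close> of cylindrical coordinates the Jacobian is integrated by Fubini; the factor
  \<open>R\<^sup>2 / 3\<close> is the radial integral of \<open>R\<^sup>2 \<rho>\<^sup>2\<close> over the unit interval.
\<close>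

lemma measure_spherical_coordinates_image:
  fixes B :: "(real \<times> real) set"
  assumes R: "R > 0" and B [measurable]: "B \<in> sets borel" and sub: "B \<subseteq> {-R<..<R} \<times> {0..<2 * pi}"
  defines "S \<equiv> {x. 0 < x$1 \<and> x$1 < 1 \<and> (x$2, x$3) \<in> B}"
  shows "spherical_coordinates R ` S \<in> lmeasurable \<and>
    measure lebesgue (spherical_coordinates R ` S) = R\<^sup>2 / 3 * measure lborel B"
proof -
  have nth [measurable]: "(\<lambda>x. x $ i) \<in> borel_measurable borel" for i :: 3 and x :: "real^3"
    by (intro borel_measurable_continuous_onI continuous_intros)
  have S [measurable]: "S \<in> sets borel"
    unfolding S_def by measurable
  have "bounded B"
    using sub bounded_subset[OF bounded_Times[of "{-R..R}" "{0..2 * pi}"], of B] by force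
  then have fin: "emeasure lborel B < \<infinity>" by (rule emeasure_bounded_finite)
  let ?f = "\<lambda>r::real. R\<^sup>2 * r\<^sup>2 * indicator {0<..<1} r"
  have radial: "(\<integral>\<^sup>+r. ennreal (?f r) \<partial>lborel) = ennreal (R\<^sup>2 / 3)"
  proof -
    have "(\<integral>\<^sup>+r. ennreal (R\<^sup>2 * r\<^sup>2) * indicator {0..1} r \<partial>lborel) = ennreal (R\<^sup>2 * 1^3/3 - R\<^sup>2 * 0^3/3)"
      by (rule nn_integral_FTC_Icc[where F = "\<lambda>r. R\<^sup>2 * r^3 / 3"])
        (auto intro!: derivative_eq_intros)
    moreover have "(\<integral>\<^sup>+r. ennreal (?f r) \<partial>lborel)
        = (\<integral>\<^sup>+r. ennreal (R\<^sup>2 * r\<^sup>2) * indicator {0..1} r \<partial>lborel)"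
      by (rule nn_integral_cong_AE, use AE_lborel_singleton[of 0] AE_lborel_singleton[of 1] in eventually_elim)
        (auto split: split_indicator)
    ultimately show ?thesis by simp
  qed
  let ?h = "\<lambda>(r, z, \<phi>). vector [r, z, \<phi>] :: real^3"
  let ?F = "\<lambda>x. ennreal (R\<^sup>2 * (x$1)\<^sup>2 * indicator S x)"
  have F: "?F \<in> borel_measurable borel" by measurable
  have "(\<integral>\<^sup>+x. ennreal (R\<^sup>2 * (x$1)\<^sup>2 * indicator S x) \<partial>lborel)
     = (\<integral>\<^sup>+p. ennreal (?f (fst p)) * indicator B (snd p) \<partial>(lborel \<Otimes>\<^sub>M lborel))"
  proof -
    have "(\<integral>\<^sup>+x. ?F x \<partial>lborel) = (\<integral>\<^sup>+x. ?F x \<partial>distr lborel borel ?h)"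
      by (simp only: lborel_vector_3)
    also have "\<dots> = (\<integral>\<^sup>+p. ?F (?h p) \<partial>lborel)"
      using F borel_measurable_vector_3 by (subst nn_integral_distr) auto
    also have "\<dots> = (\<integral>\<^sup>+p. ennreal (?f (fst p)) * indicator B (snd p) \<partial>lborel)"
      by (rule nn_integral_cong) (auto simp: S_def split: split_indicator)
    finally show ?thesis by (simp only: lborel_prod)
  qed
  also have "\<dots> = (\<integral>\<^sup>+r. \<integral>\<^sup>+q. ennreal (?f r) * indicator B q \<partial>lborel \<partial>lborel)"
    by (subst lborel.nn_integral_fst[symmetric]) auto
  also have "\<dots> = (\<integral>\<^sup>+r. ennreal (?f r) * emeasure lborel B \<partial>lborel)"
    by (simp add: nn_integral_cmult)
  also have "\<dots> = ennreal (R\<^sup>2 / 3) * emeasure lborel B"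
    by (simp add: nn_integral_multc radial)
  also have "\<dots> = ennreal (R\<^sup>2 / 3 * measure lborel B)"
    using fin by (subst emeasure_eq_ennreal_measure) (auto simp flip: ennreal_mult')
  finally have "((\<lambda>x. R\<^sup>2 * (x$1)\<^sup>2 * indicator S x) has_integral (R\<^sup>2 / 3 * measure lborel B)) UNIV"
    by (intro nn_integral_has_integral) auto
  then have "((\<lambda>x. if x \<in> S then R\<^sup>2 * (x$1)\<^sup>2 else 0) has_integral (R\<^sup>2 / 3 * measure lborel B)) UNIV"
    by (rule has_integral_eq[rotated]) auto
  then have "((\<lambda>x. R\<^sup>2 * (x$1)\<^sup>2) has_integral (R\<^sup>2 / 3 * measure lborel B)) S"
    by (simp add: has_integral_restrict_UNIV)
  moreover have lat: "\<bar>x$2\<bar> < R" if "x \<in> S" for x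
    using subsetD[OF sub, of "(x$2, x$3)"] that by (auto simp: S_def)
  ultimately have "((\<lambda>x. \<bar>det (matrix (spherical_coordinates_derivative R x))\<bar>)
      has_integral (R\<^sup>2 / 3 * measure lborel B)) S"
    by (subst has_integral_cong[where g = "\<lambda>x. R\<^sup>2 * (x$1)\<^sup>2"])
      (auto simp: det_spherical_coordinates_derivative)
  moreover have "inj_on (spherical_coordinates R) S"
    by (rule inj_on_subset[OF inj_on_spherical_coordinates[OF R]]) (use sub in \<open>auto simp: S_def\<close>)
  ultimately show ?thesis
    by (subst has_measure_differentiable_image[where f' = "spherical_coordinates_derivative R"])
      (auto intro!: spherical_coordinates_has_derivative lat)
qed


section \<open>Coordinates with respect to an orthonormal basis\<close>

locale orthonormal_frame =
  fixes e :: "3 \<Rightarrow> 'a::euclidean_space"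
  assumes dim: "DIM('a) = 3"
    and orthonormal: "e i \<bullet> e j = (if i = j then 1 else 0)"
begin

lemma norm_frame [simp]: "norm (e i) = 1"
  by (simp add: norm_eq_sqrt_inner orthonormal)

lemma expand: "(\<Sum>i\<in>UNIV. (v \<bullet> e i) *\<^sub>R e i) = v"
proof -
  have inj: "inj e"
    by (rule injI) (metis orthonormal zero_neq_one)
  have orth: "pairwise orthogonal (range e)"
    by (auto simp: pairwise_def orthogonal_def orthonormal)
  have "0 \<notin> range e" using norm_frame by (metis norm_zero rangeE zero_neq_one)
  then have "independent (range e)" by (rule pairwise_orthogonal_independent[OF orth])
  moreover have "card (range e) = dim (UNIV :: 'a set)"
    using inj by (simp add: card_image dim)
  ultimately have "UNIV \<subseteq> span (range e)"
    by (intro card_ge_dim_independent) auto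
  then have "(\<Sum>b\<in>range e. (v \<bullet> b) *\<^sub>R b) = v"
    by (intro orthonormal_basis_expand orth) auto
  then show ?thesis by (simp add: sum.reindex[OF inj] o_def)
qed

definition vector_of :: "real^3 \<Rightarrow> 'a" where
  "vector_of x = (\<Sum>i\<in>UNIV. x $ i *\<^sub>R e i)"

definition coordinates :: "'a \<Rightarrow> real^3" where
  "coordinates v = (\<chi> i. v \<bullet> e i)"

lemma vector_of_coordinates [simp]: "vector_of (coordinates v) = v"
  by (simp add: vector_of_def coordinates_def expand)

lemma coordinates_vector_of [simp]: "coordinates (vector_of x) = x"
  by (simp add: vec_eq_iff vector_of_def coordinates_def inner_sum_left orthonormal if_distrib cong: if_cong)

lemma linear_vector_of: "linear vector_of"
  by (rule linearI) (simp_all add: vector_of_def scaleR_add_left sum.distrib scaleR_sum_right)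

lemma linear_coordinates: "linear coordinates"
  by (rule linearI) (simp_all add: coordinates_def vec_eq_iff inner_add_left)

lemma inner_vector_of: "vector_of x \<bullet> vector_of y = x \<bullet> y"
  by (simp add: vector_of_def inner_sum_left inner_sum_right orthonormal inner_vec_def mult.commute if_distrib cong: if_cong)

lemma norm_vector_of [simp]: "norm (vector_of x) = norm x"
  by (simp add: norm_eq_sqrt_inner inner_vector_of)

lemma norm_coordinates [simp]: "norm (coordinates v) = norm v"
  by (metis norm_vector_of vector_of_coordinates)

lemma vector_of_eq_0 [simp]: "vector_of x = 0 \<longleftrightarrow> x = 0"
  by (metis norm_eq_zero norm_vector_of)

lemma coordinates_eq_0 [simp]: "coordinates v = 0 \<longleftrightarrow> v = 0"
  by (metis norm_eq_zero norm_coordinates)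

section \<open>The Liouville measure as the volume of solid cones\<close>

lemma cylindrical_point_eq:
  "cylindrical_point e R (z, \<phi>) = vector_of (spherical_coordinates R (vector [1, z, \<phi>]))"
  by (simp add: cylindrical_point_def vector_of_def spherical_coordinates_def sum_3)

lemma vector_of_spherical_coordinates:
  "vector_of (spherical_coordinates R x) = x$1 *\<^sub>R cylindrical_point e R (x$2, x$3)"
  by (simp add: cylindrical_point_def vector_of_def spherical_coordinates_def sum_3 scaleR_add_right mult.assoc)

lemma norm_cylindrical_point:
  assumes "\<bar>z\<bar> < R" shows "norm (cylindrical_point e R (z, \<phi>)) = R"
  using assms norm_spherical_coordinates[of "vector [1, z, \<phi>]" R] by (simp add: cylindrical_point_eq)

lemma borel_measurable_cylindrical_point [measurable]:
  "cylindrical_point e R \<in> borel_measurable borel"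
  unfolding cylindrical_point_def case_prod_beta
  by (intro borel_measurable_continuous_onI continuous_intros)

lemma cylindrical_point_measurable:
  "cylindrical_point e R \<in> restrict_space lborel ({-R<..<R} \<times> {0..<2 * pi})
     \<rightarrow>\<^sub>M restrict_space borel (sphere 0 R)"
  by (rule measurable_restrict_space3) (auto simp: norm_cylindrical_point)

text \<open>
  The solid cone over \<open>A\<close> without its apex, in coordinates.  It is a subset of \<open>real^3\<close> for every
  frame, so that the cones belonging to different frames can be compared.
\<close>

definition cone :: "real \<Rightarrow> 'a set \<Rightarrow> (real^3) set" where
  "cone R A = {x. 0 < norm x \<and> norm x < R \<and> (R / norm x) *\<^sub>R vector_of x \<in> A}"

lemma space_liouville [simp]: "space (sphere_liouville_measure e R) = sphere 0 R"
  by (simp add: sphere_liouville_measure_def space_restrict_space)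

lemma sets_liouville: "sets (sphere_liouville_measure e R) = sets (restrict_space borel (sphere 0 R))"
  by (simp add: sphere_liouville_measure_def)

lemma rectangle_borel: "{-R<..<R} \<times> {0..<2 * pi} \<in> sets (borel :: (real \<times> real) measure)"
  by (metis borel_Times borel_open atLeastLessThan_borel open_greaterThanLessThan)

lemma emeasure_liouville:
  assumes "A \<in> sets (restrict_space borel (sphere 0 R))"
  shows "emeasure (sphere_liouville_measure e R) A =
    emeasure lborel (({-R<..<R} \<times> {0..<2 * pi}) \<inter> cylindrical_point e R -` A)"
  unfolding sphere_liouville_measure_def
  using assms rectangle_borel[of R]
  by (simp add: emeasure_distr[OF cylindrical_point_measurable] emeasure_restrict_space
      space_restrict_space Int_commute)

text \<open>
  Spherical coordinates reach all of the cone except for points on the axis of the poles.  The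
  lemma allows for the loss of a whole coordinate plane, which is negligible as well.
\<close>

lemma cone_eq_image_up_to_plane:
  assumes R: "R > 0"
  defines "D \<equiv> {-R<..<R} \<times> {0..<2 * pi}"
  defines "S A \<equiv> {x. 0 < x$1 \<and> x$1 < 1 \<and> (x$2, x$3) \<in> D \<inter> cylindrical_point e R -` A}"
  shows "spherical_coordinates R ` S A \<subseteq> cone R A"
    and "cone R A - spherical_coordinates R ` S A \<subseteq> {x. x $ 1 = 0}"
proof safe
  fix x assume x: "x \<in> S A"
  then have "norm (spherical_coordinates R x) = R * x$1"
    by (intro norm_spherical_coordinates) (auto simp: S_def D_def)
  with x R show "spherical_coordinates R x \<in> cone R A"
    by (auto simp: cone_def S_def vector_of_spherical_coordinates)
next
  fix x assume x: "x \<in> cone R A" and nin: "x \<notin> spherical_coordinates R ` S A"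
  show "x $ 1 = 0"
  proof (rule ccontr)
    assume x1: "x $ 1 \<noteq> 0"
    define \<rho> where "\<rho> = norm x / R"
    have \<rho>: "0 < \<rho>" "\<rho> < 1" using x R by (auto simp: cone_def \<rho>_def)
    define z where "z = x$3 / \<rho>"
    have nx: "(norm x)\<^sup>2 = (x$1)\<^sup>2 + (x$2)\<^sup>2 + (x$3)\<^sup>2"
      unfolding power2_norm_eq_inner inner_vec_def sum_3 by (simp add: power2_eq_square)
    have \<rho>R: "(\<rho> * R)\<^sup>2 = (x$1)\<^sup>2 + (x$2)\<^sup>2 + (x$3)\<^sup>2" using R nx by (simp add: \<rho>_def)
    have s2: "\<rho>\<^sup>2 * (R\<^sup>2 - z\<^sup>2) = (x$1)\<^sup>2 + (x$2)\<^sup>2"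
      using \<rho>R \<rho> by (simp add: z_def power_divide power_mult_distrib right_diff_distrib)
    moreover have pos: "(x$1)\<^sup>2 + (x$2)\<^sup>2 > 0" using x1 by (simp add: add_pos_nonneg)
    ultimately have "R\<^sup>2 - z\<^sup>2 > 0"
      by (metis \<rho>(1) zero_less_mult_pos zero_less_power)
    then have z: "\<bar>z\<bar> < R" using R power2_less_imp_less[of "\<bar>z\<bar>" R] by simp
    define s where "s = sqrt (R\<^sup>2 - z\<^sup>2)"
    have s: "s > 0" "s\<^sup>2 = R\<^sup>2 - z\<^sup>2" using \<open>R\<^sup>2 - z\<^sup>2 > 0\<close> by (auto simp: s_def)
    have "(x$1 / (\<rho> * s))\<^sup>2 + (x$2 / (\<rho> * s))\<^sup>2 = ((x$1)\<^sup>2 + (x$2)\<^sup>2) / (\<rho>\<^sup>2 * s\<^sup>2)"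
      by (simp add: power_divide power_mult_distrib add_divide_distrib)
    also have "\<dots> = 1"
      using pos unfolding s(2) s2 by (metis divide_self less_irrefl)
    finally have "(x$1 / (\<rho> * s))\<^sup>2 + (x$2 / (\<rho> * s))\<^sup>2 = 1" .
    then obtain \<phi> where \<phi>: "0 \<le> \<phi>" "\<phi> < 2 * pi" "x$1 / (\<rho> * s) = cos \<phi>" "x$2 / (\<rho> * s) = sin \<phi>"
      by (metis sincos_total_2pi)
    define y :: "real^3" where "y = vector [\<rho>, z, \<phi>]"
    have "x$1 = \<rho> * s * cos \<phi>" "x$2 = \<rho> * s * sin \<phi>"
      using \<phi>(3,4) \<rho> s by (simp_all add: field_simps)
    moreover have "x$3 = \<rho> * z" using \<rho> by (simp add: z_def)
    ultimately have y: "spherical_coordinates R y = x"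
      by (simp add: y_def spherical_coordinates_def s_def vec_eq_iff forall_3)
    have "vector_of x = \<rho> *\<^sub>R cylindrical_point e R (z, \<phi>)"
      using vector_of_spherical_coordinates[of R y] y by (simp add: y_def)
    then have "(R / norm x) *\<^sub>R vector_of x = cylindrical_point e R (z, \<phi>)"
      using \<rho> R by (auto simp: \<rho>_def)
    then have "y \<in> S A"
      using x \<rho> z \<phi> by (auto simp: S_def D_def cone_def y_def)
    with nin y show False by blast
  qed
qed

text \<open>
  The right-hand side refers to the cylindrical coordinates of the frame, the left-hand side only to
  the volume of a solid; this is what makes the Liouville measure independent of the frame.
\<close>

lemma measure_cone:
  assumes R: "R > 0" and A: "A \<in> sets (restrict_space borel (sphere 0 R))"
  shows "cone R A \<in> lmeasurable"
    and "measure lebesgue (cone R A) = R\<^sup>2 / 3 * measure (sphere_liouville_measure e R) A"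
proof -
  define B where "B = ({-R<..<R} \<times> {0..<2 * pi}) \<inter> cylindrical_point e R -` A"
  define S where "S = {x::real^3. 0 < x$1 \<and> x$1 < 1 \<and> (x$2, x$3) \<in> B}"
  have [measurable]: "A \<in> sets borel" using A by (auto simp: sets_restrict_space)
  have "cylindrical_point e R -` A \<in> sets borel"
    using measurable_sets[OF borel_measurable_cylindrical_point] by (metis \<open>A \<in> sets borel\<close> space_borel Int_UNIV_right)
  then have "B \<in> sets borel" unfolding B_def using rectangle_borel by blast
  then have img: "spherical_coordinates R ` S \<in> lmeasurable"
    "measure lebesgue (spherical_coordinates R ` S) = R\<^sup>2 / 3 * measure lborel B"
    using measure_spherical_coordinates_image[OF R, of B] by (auto simp: S_def B_def)
  have neg: "negligible (sym_diff (spherical_coordinates R ` S) (cone R A))"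
    by (rule negligible_subset[OF negligible_standard_hyperplane_cart[of 1]])
      (use cone_eq_image_up_to_plane[OF R, of A] in \<open>auto simp: S_def B_def\<close>)
  show "cone R A \<in> lmeasurable"
    by (rule lmeasurable_negligible_symdiff[OF img(1) neg])
  have "measure lebesgue (cone R A) = R\<^sup>2 / 3 * measure lborel B"
    using measure_negligible_symdiff[OF img(1) neg] img(2) by simp
  then show "measure lebesgue (cone R A) = R\<^sup>2 / 3 * measure (sphere_liouville_measure e R) A"
    using emeasure_liouville[OF A] by (simp add: measure_def B_def)
qed

lemma finite_measure_liouville: "finite_measure (sphere_liouville_measure e R)"
proof
  have "{-R<..<R} \<times> {0..<2 * pi} \<subseteq> {-R..R} \<times> {0..2 * pi}" by auto
  then have "bounded ({-R<..<R} \<times> {0..<2 * pi})"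
    by (rule bounded_subset[OF bounded_Times[OF bounded_closed_interval bounded_closed_interval]])
  then have "emeasure lborel ({-R<..<R} \<times> {0..<2 * pi}) < \<infinity>" by (rule emeasure_bounded_finite)
  moreover have "emeasure (sphere_liouville_measure e R) (sphere 0 R)
      \<le> emeasure lborel ({-R<..<R} \<times> {0..<2 * pi})"
    by (subst emeasure_liouville) (auto intro!: emeasure_mono rectangle_borel simp: sets_restrict_space)
  ultimately show "emeasure (sphere_liouville_measure e R) (space (sphere_liouville_measure e R)) \<noteq> \<infinity>"
    by auto
qed

end

text \<open>
  Passing from the coordinates of one frame to those of the other is an orthogonal transformation
  that carries the cones of the first frame to those of the second.
\<close>

lemma sphere_liouville_measure_unique:
  assumes "orthonormal_frame a" "orthonormal_frame e" "R > 0"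
  shows "sphere_liouville_measure a R = sphere_liouville_measure e R"
proof (rule measure_eqI)
  interpret a: orthonormal_frame a by fact
  interpret e: orthonormal_frame e by fact
  interpret fa: finite_measure "sphere_liouville_measure a R" by (rule a.finite_measure_liouville)
  interpret fe: finite_measure "sphere_liouville_measure e R" by (rule e.finite_measure_liouville)
  show "sets (sphere_liouville_measure a R) = sets (sphere_liouville_measure e R)"
    by (simp add: a.sets_liouville e.sets_liouville)
  fix A assume "A \<in> sets (sphere_liouville_measure a R)"
  then have A: "A \<in> sets (restrict_space borel (sphere 0 R))" by (simp add: a.sets_liouville)
  let ?Q = "e.coordinates \<circ> a.vector_of"
  have Q: "orthogonal_transformation ?Q"
    unfolding orthogonal_transformation
    using linear_compose[OF a.linear_vector_of e.linear_coordinates] by simp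
  have "e.cone R A = ?Q ` a.cone R A"
  proof (intro equalityI subsetI)
    fix x assume x: "x \<in> e.cone R A"
    then have "a.coordinates (e.vector_of x) \<in> a.cone R A"
      by (simp add: a.cone_def e.cone_def)
    moreover have "x = ?Q (a.coordinates (e.vector_of x))" by simp
    ultimately show "x \<in> ?Q ` a.cone R A" by blast
  next
    fix x assume "x \<in> ?Q ` a.cone R A"
    then show "x \<in> e.cone R A" by (auto simp: a.cone_def e.cone_def)
  qed
  then have "measure lebesgue (e.cone R A) = measure lebesgue (a.cone R A)"
    using measure_orthogonal_image[OF Q a.measure_cone(1)[OF assms(3) A]] by simp
  then have "measure (sphere_liouville_measure a R) A = measure (sphere_liouville_measure e R) A"
    using a.measure_cone(2)[OF assms(3) A] e.measure_cone(2)[OF assms(3) A] assms(3) by simp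
  then show "emeasure (sphere_liouville_measure a R) A = emeasure (sphere_liouville_measure e R) A"
    by (simp add: fa.emeasure_eq_measure fe.emeasure_eq_measure)
qed


section \<open>Integration over the sphere\<close>

lemma has_bochner_integral_lborel_product:
  fixes u v :: "real \<Rightarrow> real"
  assumes u: "has_bochner_integral lborel u c" and v: "has_bochner_integral lborel v d"
  shows "has_bochner_integral lborel (\<lambda>p. u (fst p) * v (snd p)) (c * d)"
proof -
  have iu: "integrable lborel u" and iv: "integrable lborel v"
    using u v by (auto simp: has_bochner_integral_iff)
  note [measurable] = borel_measurable_integrable[OF iu] borel_measurable_integrable[OF iv]
  have int: "integrable (lborel \<Otimes>\<^sub>M lborel) (\<lambda>(x, y). u x * v y)"
    by (rule lborel_pair.Fubini_integrable) (use iu iv in \<open>auto simp: abs_mult\<close>)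
  have "integral\<^sup>L (lborel \<Otimes>\<^sub>M lborel) (\<lambda>(x, y). u x * v y) = c * d"
    using lborel_pair.integral_fst[OF int] u v by (simp add: has_bochner_integral_iff)
  with int show ?thesis
    unfolding lborel_prod by (simp add: has_bochner_integral_iff case_prod_beta')
qed

lemma has_bochner_integral_lborel_cong_except_two:
  fixes f g :: "real \<Rightarrow> real"
  assumes "has_bochner_integral lborel f c" "\<And>x. x \<noteq> s \<Longrightarrow> x \<noteq> t \<Longrightarrow> f x = g x"
    and "g \<in> borel_measurable borel"
  shows "has_bochner_integral lborel g c"
proof -
  have "AE x in lborel. f x = g x"
    using AE_lborel_singleton[of s] AE_lborel_singleton[of t] by eventually_elim (use assms(2) in auto)
  moreover have "f \<in> borel_measurable lborel" using assms(1) by (rule borel_measurable_has_bochner_integral)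
  ultimately show ?thesis
    using assms(1,3) has_bochner_integral_cong_AE[of f lborel g c] by simp
qed

context orthonormal_frame
begin

text \<open>
  The fundamental theorem of calculus yields integrals over closed intervals, hence the closed
  intervals in the hypotheses; their end points form a null set.
\<close>

lemma has_bochner_integral_liouville:
  fixes f :: "'a \<Rightarrow> real"
  assumes f [measurable]: "f \<in> borel_measurable borel"
    and u [measurable]: "u \<in> borel_measurable borel" and v [measurable]: "v \<in> borel_measurable borel"
    and fuv: "\<And>z \<phi>. \<bar>z\<bar> < R \<Longrightarrow> f (cylindrical_point e R (z, \<phi>)) = u z * v \<phi>"
    and U: "has_bochner_integral lborel (\<lambda>z. u z * indicator {-R..R} z) c"
    and V: "has_bochner_integral lborel (\<lambda>\<phi>. v \<phi> * indicator {0..2 * pi} \<phi>) d"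
  shows "has_bochner_integral (sphere_liouville_measure e R) f (c * d)"
proof -
  let ?D = "{-R<..<R} \<times> {0..<2 * pi}"
  have "has_bochner_integral lborel (\<lambda>z. u z * indicator {-R<..<R} z) c"
    by (rule has_bochner_integral_lborel_cong_except_two[OF U, of "-R" R]) (auto split: split_indicator)
  moreover have "has_bochner_integral lborel (\<lambda>\<phi>. v \<phi> * indicator {0..<2 * pi} \<phi>) d"
    by (rule has_bochner_integral_lborel_cong_except_two[OF V, of "2 * pi" "2 * pi"]) (auto split: split_indicator)
  ultimately have "has_bochner_integral lborel
      (\<lambda>p. (u (fst p) * indicator {-R<..<R} (fst p)) * (v (snd p) * indicator {0..<2 * pi} (snd p))) (c * d)"
    by (rule has_bochner_integral_lborel_product)
  moreover have "(u (fst p) * indicator {-R<..<R} (fst p)) * (v (snd p) * indicator {0..<2 * pi} (snd p))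
      = indicator ?D p *\<^sub>R f (cylindrical_point e R p)" for p
    using fuv[of "fst p" "snd p"] by (auto simp: mem_Times_iff split: split_indicator)
  ultimately have "has_bochner_integral lborel (\<lambda>p. indicator ?D p *\<^sub>R f (cylindrical_point e R p)) (c * d)"
    by simp
  then have "has_bochner_integral (restrict_space lborel ?D) (\<lambda>p. f (cylindrical_point e R p)) (c * d)"
    using rectangle_borel[of R]
    by (simp add: has_bochner_integral_iff integrable_restrict_space integral_restrict_space)
  then show ?thesis
    unfolding sphere_liouville_measure_def
    by (intro has_bochner_integral_distr measurable_restrict_space1 f cylindrical_point_measurable)
qed

lemma cylindrical_point_inner:
  "cylindrical_point e R (z, \<phi>) \<bullet> e 1 = sqrt (R\<^sup>2 - z\<^sup>2) * cos \<phi>"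
  "cylindrical_point e R (z, \<phi>) \<bullet> e 2 = sqrt (R\<^sup>2 - z\<^sup>2) * sin \<phi>"
  "cylindrical_point e R (z, \<phi>) \<bullet> e 3 = z"
  by (simp_all add: cylindrical_point_def inner_add_left orthonormal)

lemma has_bochner_integral_full_turn:
  "has_bochner_integral lborel (\<lambda>\<phi>. 1 * indicator {0..2 * pi} \<phi>) (2 * pi)"
  "has_bochner_integral lborel (\<lambda>\<phi>. cos \<phi> * indicator {0..2 * pi} \<phi>) 0"
  "has_bochner_integral lborel (\<lambda>\<phi>. sin \<phi> * indicator {0..2 * pi} \<phi>) 0"
proof -
  show "has_bochner_integral lborel (\<lambda>\<phi>. 1 * indicator {0..2 * pi} \<phi>) (2 * pi)"
    using has_bochner_integral_FTC_Icc_real[of 0 "2 * pi" "\<lambda>x. x" "\<lambda>_. 1"] by simp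
  show "has_bochner_integral lborel (\<lambda>\<phi>. cos \<phi> * indicator {0..2 * pi} \<phi>) 0"
    using has_bochner_integral_FTC_Icc_real[of 0 "2 * pi" sin cos] by simp
  show "has_bochner_integral lborel (\<lambda>\<phi>. sin \<phi> * indicator {0..2 * pi} \<phi>) 0"
  proof -
    have "((\<lambda>x. - cos x) has_real_derivative sin x) (at x)" for x :: real
      by (auto intro!: derivative_eq_intros)
    then show ?thesis
      using has_bochner_integral_FTC_Icc_real[of 0 "2 * pi" "\<lambda>x. - cos x" sin] by simp
  qed
qed

lemma integral_exp_height:
  assumes "R > 0" "b > 0"
  shows "has_bochner_integral (sphere_liouville_measure e R) (\<lambda>r. exp (- b * (r \<bullet> e 3)))
    (4 * pi * sinh (R * b) / b)"
proof -
  have "has_bochner_integral lborel (\<lambda>z. exp (- b * z) * indicator {-R..R} z)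
      (- exp (- b * R) / b - - exp (- b * - R) / b)"
    using assms by (intro has_bochner_integral_FTC_Icc_real) (auto intro!: derivative_eq_intros)
  from has_bochner_integral_liouville[OF _ _ _ _ this has_bochner_integral_full_turn(1), of "\<lambda>r. exp (- b * (r \<bullet> e 3))"]
  have "has_bochner_integral (sphere_liouville_measure e R) (\<lambda>r. exp (- b * (r \<bullet> e 3)))
      ((- exp (- b * R) / b - - exp (- b * - R) / b) * (2 * pi))"
    by (simp add: cylindrical_point_inner)
  moreover have "(- exp (- b * R) / b - - exp (- b * - R) / b) * (2 * pi) = 4 * pi * sinh (R * b) / b"
    using assms by (simp add: sinh_field_def field_simps)
  ultimately show ?thesis by simp
qed

lemma integral_height_exp_height:
  assumes "R > 0" "b > 0"
  shows "has_bochner_integral (sphere_liouville_measure e R) (\<lambda>r. exp (- b * (r \<bullet> e 3)) * (r \<bullet> e 3))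
    (4 * pi * sinh (R * b) / b * ((1 - R * b * coth (R * b)) / b))"
proof -
  let ?F = "\<lambda>z. - (z / b + 1 / b\<^sup>2) * exp (- b * z)"
  have "has_bochner_integral lborel (\<lambda>z. (exp (- b * z) * z) * indicator {-R..R} z) (?F R - ?F (- R))"
    using assms by (intro has_bochner_integral_FTC_Icc_real)
      (auto intro!: derivative_eq_intros simp: field_simps power2_eq_square)
  from has_bochner_integral_liouville[OF _ _ _ _ this has_bochner_integral_full_turn(1),
      of "\<lambda>r. exp (- b * (r \<bullet> e 3)) * (r \<bullet> e 3)"]
  have "has_bochner_integral (sphere_liouville_measure e R) (\<lambda>r. exp (- b * (r \<bullet> e 3)) * (r \<bullet> e 3))
      ((?F R - ?F (- R)) * (2 * pi))"
    by (simp add: cylindrical_point_inner)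
  moreover have "(?F R - ?F (- R)) * (2 * pi) = 4 * pi * sinh (R * b) / b * ((1 - R * b * coth (R * b)) / b)"
  proof -
    have "sinh (R * b) \<noteq> 0" using assms by simp
    then have "4 * pi * sinh (R * b) / b * ((1 - R * b * coth (R * b)) / b)
        = 4 * pi * (sinh (R * b) - R * b * cosh (R * b)) / b\<^sup>2"
      by (simp add: coth_def field_simps power2_eq_square)
    also have "\<dots> = (?F R - ?F (- R)) * (2 * pi)"
      using assms by (simp add: sinh_field_def cosh_field_def field_simps power2_eq_square)
    finally show ?thesis by simp
  qed
  ultimately show ?thesis by simp
qed

text \<open>
  The Gibbs weight is invariant under rotations about \<open>e 3\<close>, so it has no horizontal moment.
\<close>

lemma integral_horizontal_exp_height:
  assumes "i \<in> {1, 2}"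
  shows "has_bochner_integral (sphere_liouville_measure e R) (\<lambda>r. exp (- b * (r \<bullet> e 3)) * (r \<bullet> e i)) 0"
proof -
  let ?u = "\<lambda>z. exp (- b * z) * sqrt (R\<^sup>2 - z\<^sup>2)"
  have "integrable lborel (\<lambda>z. ?u z * indicator {-R..R} z)"
    using borel_integrable_compact[of "{-R..R}" ?u]
    by (simp add: continuous_intros mult.commute)
  then have U: "has_bochner_integral lborel (\<lambda>z. ?u z * indicator {-R..R} z)
      (integral\<^sup>L lborel (\<lambda>z. ?u z * indicator {-R..R} z))"
    by (rule has_bochner_integral_integrable)
  from assms consider "i = 1" | "i = 2" by auto
  then show ?thesis
  proof cases
    case 1
    with has_bochner_integral_liouville[OF _ _ _ _ U has_bochner_integral_full_turn(2),
      of "\<lambda>r. exp (- b * (r \<bullet> e 3)) * (r \<bullet> e 1)"] show ?thesis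
      by (simp add: cylindrical_point_inner)
  next
    case 2
    with has_bochner_integral_liouville[OF _ _ _ _ U has_bochner_integral_full_turn(3),
      of "\<lambda>r. exp (- b * (r \<bullet> e 3)) * (r \<bullet> e 2)"] show ?thesis
      by (simp add: cylindrical_point_inner)
  qed
qed

lemma measure_liouville_sphere:
  assumes "R > 0"
  shows "measure (sphere_liouville_measure e R) (sphere 0 R) = 4 * pi * R"
proof -
  have "has_bochner_integral lborel (\<lambda>z. 1 * indicator {-R..R} z) (R - - R)"
    using assms by (intro has_bochner_integral_FTC_Icc_real) auto
  then have "has_bochner_integral (sphere_liouville_measure e R) (\<lambda>_. 1 :: real) ((R - - R) * (2 * pi))"
    by (intro has_bochner_integral_liouville[OF _ _ _ _ _ has_bochner_integral_full_turn(1)]) auto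
  then show ?thesis by (simp add: has_bochner_integral_iff)
qed

section \<open>Gibbs states on the sphere\<close>

text \<open>
  Since \<open>\<bar>r \<bullet> \<beta>'\<bar> \<le> R * norm \<beta>'\<close> on the sphere, a constant bounds the Gibbs weights of all \<open>\<beta>'\<close>
  in the unit ball around \<open>\<beta>\<close>.
\<close>

lemma generalized_temperatures_sphere:
  assumes "R > 0"
  shows "generalized_temperatures (sphere_liouville_measure e R) (\<lambda>r. r) = UNIV"
proof -
  interpret finite_measure "sphere_liouville_measure e R" by (rule finite_measure_liouville)
  have "\<beta> \<in> generalized_temperatures (sphere_liouville_measure e R) (\<lambda>r. r)" for \<beta>
    unfolding generalized_temperatures_def
  proof (intro CollectI exI conjI ballI)
    fix \<beta>' r assume \<beta>': "\<beta>' \<in> ball \<beta> 1" and r: "r \<in> space (sphere_liouville_measure e R)"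
    have "norm \<beta>' \<le> norm \<beta> + 1"
      using \<beta>' norm_triangle_ineq2[of \<beta>' \<beta>] by (simp add: dist_norm norm_minus_commute)
    then have "R * norm \<beta>' \<le> R * (norm \<beta> + 1)" using assms by simp
    moreover have "- (r \<bullet> \<beta>') \<le> R * norm \<beta>'"
      using Cauchy_Schwarz_ineq2[of r \<beta>'] r by simp
    ultimately show "exp (- (r \<bullet> \<beta>')) \<le> exp (R * (norm \<beta> + 1))" by simp
  qed auto
  then show ?thesis by auto
qed

lemma partition_function_sphere:
  assumes "R > 0" "b \<ge> 0"
  shows "partition_function (sphere_liouville_measure e R) (\<lambda>r. r) (b *\<^sub>R e 3) =
    (if b > 0 then 4 * pi * sinh (R * b) / b else 4 * pi * R)"
proof (cases "b > 0")
  case True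
  with integral_exp_height[OF assms(1) True] show ?thesis
    by (simp add: partition_function_def has_bochner_integral_iff)
next
  case False
  with assms have "b = 0" by simp
  then show ?thesis
    using measure_liouville_sphere[OF assms(1)] by (simp add: partition_function_def)
qed

lemma mean_moment_sphere:
  assumes "R > 0" "b > 0"
  shows "mean_moment (sphere_liouville_measure e R) (\<lambda>r. r) (b *\<^sub>R e 3) =
    ((1 - R * b * coth (R * b)) / b\<^sup>2) *\<^sub>R (b *\<^sub>R e 3)"
proof -
  let ?L = "sphere_liouville_measure e R"
  define P where "P = 4 * pi * sinh (R * b) / b"
  define m where "m = (1 - R * b * coth (R * b)) / b"
  have P: "P > 0"
    unfolding P_def using assms by (intro divide_pos_pos mult_pos_pos) auto
  have gibbs: "gibbs_density ?L (\<lambda>r. r) (b *\<^sub>R e 3) r = exp (- b * (r \<bullet> e 3)) / P" for r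
    using partition_function_sphere[OF assms(1), of b] assms by (simp add: gibbs_density_def P_def)
  have comp: "has_bochner_integral ?L (\<lambda>r. exp (- b * (r \<bullet> e 3)) * (r \<bullet> e i)) (if i = 3 then P * m else 0)" for i
    using integral_height_exp_height[OF assms] integral_horizontal_exp_height[of i R b] exhaust_3[of i]
    by (auto simp: P_def m_def)
  \<comment> \<open>The vector-valued integral is assembled from its components along the frame.\<close>
  have "has_bochner_integral ?L (\<lambda>r. \<Sum>i\<in>UNIV. ((1 / P) * (exp (- b * (r \<bullet> e 3)) * (r \<bullet> e i))) *\<^sub>R e i)
      (\<Sum>i\<in>UNIV. ((1 / P) * (if i = 3 then P * m else 0)) *\<^sub>R e i)"
    by (intro has_bochner_integral_sum has_bochner_integral_scaleR_left has_bochner_integral_mult_right comp)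
  moreover have "(\<Sum>i\<in>UNIV. ((1 / P) * (exp (- b * (r \<bullet> e 3)) * (r \<bullet> e i))) *\<^sub>R e i)
      = gibbs_density ?L (\<lambda>r. r) (b *\<^sub>R e 3) r *\<^sub>R r" for r
    by (subst (3) expand[of r, symmetric]) (simp add: gibbs scaleR_sum_right)
  moreover have "(\<Sum>i\<in>UNIV. ((1 / P) * (if i = 3 then P * m else 0)) *\<^sub>R e i) = m *\<^sub>R e 3"
    using P by (simp add: sum_3)
  ultimately have "mean_moment ?L (\<lambda>r. r) (b *\<^sub>R e 3) = m *\<^sub>R e 3"
    by (simp add: mean_moment_def has_bochner_integral_iff)
  then show ?thesis using assms by (simp add: m_def power2_eq_square)
qed

lemma gibbs_entropy_sphere:
  assumes "R > 0" "b > 0"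
  shows "gibbs_entropy (sphere_liouville_measure e R) (\<lambda>r. r) (b *\<^sub>R e 3) =
    1 + ln (4 * pi * sinh (R * b) / b) - R * b * coth (R * b)"
proof -
  let ?L = "sphere_liouville_measure e R"
  define P where "P = 4 * pi * sinh (R * b) / b"
  define m where "m = (1 - R * b * coth (R * b)) / b"
  have P: "P > 0"
    unfolding P_def using assms by (intro divide_pos_pos mult_pos_pos) auto
  have gibbs: "gibbs_density ?L (\<lambda>r. r) (b *\<^sub>R e 3) r = exp (- b * (r \<bullet> e 3)) / P" for r
    using partition_function_sphere[OF assms(1), of b] assms by (simp add: gibbs_density_def P_def)
  \<comment> \<open>With density \<open>\<rho> = exp (- b z) / P\<close> one has \<open>ln \<rho> = - b z - ln P\<close>, so \<open>\<rho> ln \<rho>\<close> is a combination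
    of the two integrands already known.\<close>
  have "has_bochner_integral ?L (\<lambda>r. (- b / P) * (exp (- b * (r \<bullet> e 3)) * (r \<bullet> e 3))
        + (- ln P / P) * exp (- b * (r \<bullet> e 3))) ((- b / P) * (P * m) + (- ln P / P) * P)"
    using integral_exp_height[OF assms] integral_height_exp_height[OF assms]
    unfolding P_def[symmetric] m_def[symmetric]
    by (intro has_bochner_integral_add has_bochner_integral_mult_right)
  moreover have "(- b / P) * (exp (- b * (r \<bullet> e 3)) * (r \<bullet> e 3)) + (- ln P / P) * exp (- b * (r \<bullet> e 3))
      = gibbs_density ?L (\<lambda>r. r) (b *\<^sub>R e 3) r * ln (gibbs_density ?L (\<lambda>r. r) (b *\<^sub>R e 3) r)" for r
    using P unfolding gibbs by (simp add: ln_div field_simps)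
  ultimately have "gibbs_entropy ?L (\<lambda>r. r) (b *\<^sub>R e 3) = - ((- b / P) * (P * m) + (- ln P / P) * P)"
    by (simp only: gibbs_entropy_def has_bochner_integral_iff)
  also have "\<dots> = b * m + ln P" using P by simp
  finally show ?thesis using assms by (simp add: P_def m_def)
qed

end

theorem mainTheorem1:
  fixes Or :: "(3 \<Rightarrow> 'a::euclidean_space) set"
    and R :: real
    and a :: "3 \<Rightarrow> 'a"
    and L :: "'a measure"
    and J :: "'a \<Rightarrow> 'a"
  assumes "DIM('a) = 3"
    and "Or \<in> orientations"
    and "R > 0"
    and "positive_orthonormal_basis Or a"
  defines "L \<equiv> sphere_liouville_measure a R"
    and "J \<equiv> (\<lambda>r. r)"
  shows "generalized_temperatures L J = UNIV \<and>
    (\<forall>(\<beta>::'a) (e::3 \<Rightarrow> 'a) (b::real).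
       positive_orthonormal_basis Or e \<longrightarrow> b \<ge> 0 \<longrightarrow> \<beta> = b *\<^sub>R e 3 \<longrightarrow>
         partition_function L J \<beta> =
           (if b > 0 then 4 * pi * sinh (R * b) / b else 4 * pi * R) \<and>
         (\<forall>x y z :: real. x *\<^sub>R e 1 + y *\<^sub>R e 2 + z *\<^sub>R e 3 \<in> sphere 0 R \<longrightarrow>
           gibbs_density L J \<beta> (x *\<^sub>R e 1 + y *\<^sub>R e 2 + z *\<^sub>R e 3) =
             (if b > 0 then b * exp (- b * z) / (4 * pi * sinh (R * b)) else 1 / (4 * pi * R))) \<and>
         (b > 0 \<longrightarrow>
           mean_moment L J \<beta> = ((1 - R * b * coth (R * b)) / b\<^sup>2) *\<^sub>R \<beta> \<and>
           gibbs_entropy L J \<beta> =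
             1 + ln (4 * pi * sinh (R * b) / b) - R * b * coth (R * b)))"
proof -
  have frame: "orthonormal_frame f" if "positive_orthonormal_basis Or f" for f :: "3 \<Rightarrow> 'a"
    using that assms(1) by (auto simp: positive_orthonormal_basis_def orthonormal_frame_def)
  interpret a: orthonormal_frame a by (rule frame) fact
  show ?thesis
  proof (intro conjI allI impI)
    show "generalized_temperatures L J = UNIV"
      unfolding L_def J_def by (rule a.generalized_temperatures_sphere) fact
  next
    fix \<beta> e and b :: real
    assume e: "positive_orthonormal_basis Or e" and b: "b \<ge> 0" and \<beta>: "\<beta> = b *\<^sub>R e 3"
    interpret e: orthonormal_frame e using e by (rule frame)
    have L: "L = sphere_liouville_measure e R"
      unfolding L_def by (rule sphere_liouville_measure_unique) (fact a.orthonormal_frame_axioms e.orthonormal_frame_axioms assms(3))+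
    show P: "partition_function L J \<beta> = (if b > 0 then 4 * pi * sinh (R * b) / b else 4 * pi * R)"
      unfolding L J_def \<beta> using assms(3) b by (rule e.partition_function_sphere)
    show "gibbs_density L J \<beta> (x *\<^sub>R e 1 + y *\<^sub>R e 2 + z *\<^sub>R e 3) =
        (if b > 0 then b * exp (- b * z) / (4 * pi * sinh (R * b)) else 1 / (4 * pi * R))" for x y z
    proof -
      have "J (x *\<^sub>R e 1 + y *\<^sub>R e 2 + z *\<^sub>R e 3) \<bullet> \<beta> = b * z"
        by (simp add: J_def \<beta> inner_add_left e.orthonormal)
      then show ?thesis using b by (auto simp: gibbs_density_def P)
    qed
    assume "b > 0"
    then show "mean_moment L J \<beta> = ((1 - R * b * coth (R * b)) / b\<^sup>2) *\<^sub>R \<beta>"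
      and "gibbs_entropy L J \<beta> = 1 + ln (4 * pi * sinh (R * b) / b) - R * b * coth (R * b)"
      unfolding L J_def \<beta> using assms(3)
      by (simp_all only: e.mean_moment_sphere e.gibbs_entropy_sphere)
  qed
qed

end
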